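(* Let $k,m,n$ be positive integers with $m\le k$ and $n\ge k-m+1$. The number of vertices (elements) of $L^k(m,n)$ is $$\binom{k+1}{m}+(n-k+m-1)\binom{k}{m-1}.$$
   Context: Fix an integer $k\ge1$. A partition $\lambda=(\lambda_1\ge\dots\ge\lambda_\ell>0)$ is a finite (possibly empty) non-increasing sequence of positive integers, $|\lambda|=\sum_i\lambda_i$, $\ell(\lambda)$ is the number of parts, and $\lambda_i=0$ for $i>\ell(\lambda)$. Its diagram is the set of cells $(i,j)$ with $1\le j\le\lambda_i$ (row $i$, column $j$; row 1 is the lowest row, and "above" means larger row index). $\lambda\subseteq\mu$ means $\lambda_i\le\mu_i$ for all $i$. A partition is $k$-bounded if $\lambda_1\le k$; $\mathcal P^k$ is the set of $k$-bounded partitions. $(m^n)$ is the partition with $n$ parts equal to $m$. For partitions $\rho\subseteq\gamma$, the skew diagram $\gamma/\rho$ is $\{(i,j):\rho_i<j\le\gamma_i\}$; the squares of $\rho$ are said to lie below $\gamma/\rho$. For a square $(i,j)\in\gamma$ (possibly in $\rho$), its hook-length in $\gamma/\rho$ is the number of cells of $\gamma/\rho$ of the form $(i,j')$ with $j'\ge j$ or $(i',j)$ with $i'\ge i$. For $\lambda\in\mathcal P^k$, the $k$-skew diagram $\lambda/^k$ is the unique skew diagram such that (i) row $i$ has $\lambda_i$ cells, (ii) no cell of the diagram has hook-length exceeding $k$, (iii) every square below the diagram has hook-length exceeding $k$. The column lengths of $\lambda/^k$ form a $k$-bounded partition, called the $k$-conjugate $\lambda^{\omega_k}$. For $\lambda,\mu\in\mathcal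 P^k$ write $\lambda\prec\!\!\cdot\,\mu$ when $\lambda\subseteq\mu$, $\lambda^{\omega_k}\subseteq\mu^{\omega_k}$ and $|\mu|-|\lambda|=1$. The partial order $\preceq$ on $\mathcal P^k$ is the reflexive-transitive closure of $\prec\!\!\cdot$; the resulting poset is $Y^k$. For $1\le m\le k$ and $n\ge1$, $L^k(m,n)=\{\mu\in\mathcal P^k:\mu\preceq(m^n)\}$ is the principal order ideal of $Y^k$ generated by $(m^n)$. *)

theory Defs
  imports "HOL-Library.More_List"
begin

text \<open>
  A partition is the list of its parts. Rows and columns of diagrams are indexed from 0,
  so that row \<open>i\<close> of the diagram of \<open>lam\<close> consists of the cells \<open>(i, j)\<close> with \<open>j < part lam i\<close>.
\<close>

definition is_partition :: "nat list \<Rightarrow> bool" where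
  "is_partition lam \<longleftrightarrow> sorted_wrt (\<ge>) lam \<and> (\<forall>p \<in> set lam. 0 < p)"

definition part :: "nat list \<Rightarrow> nat \<Rightarrow> nat" where
  "part lam i = nth_default 0 lam i"

definition diagram :: "nat list \<Rightarrow> (nat \<times> nat) set" where
  "diagram lam = {(i, j). j < part lam i}"

definition contained :: "nat list \<Rightarrow> nat list \<Rightarrow> bool" where
  "contained lam mu \<longleftrightarrow> (\<forall>i. part lam i \<le> part mu i)"

definition bounded_partitions :: "nat \<Rightarrow> nat list set" where
  "bounded_partitions k = {lam. is_partition lam \<and> part lam 0 \<le> k}"

definition skew_diagram :: "nat list \<Rightarrow> nat list \<Rightarrow> (nat \<times> nat) set" where
  "skew_diagram gam rho = {(i, j). part rho i \<le> j \<and> j < part gam i}"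

definition hook_length :: "nat list \<Rightarrow> nat list \<Rightarrow> nat \<times> nat \<Rightarrow> nat" where
  "hook_length gam rho = (\<lambda>(i, j).
     card {(i', j') \<in> skew_diagram gam rho. (i' = i \<and> j \<le> j') \<or> (i \<le> i' \<and> j' = j)})"

definition is_k_skew :: "nat \<Rightarrow> nat list \<Rightarrow> nat list \<Rightarrow> nat list \<Rightarrow> bool" where
  "is_k_skew k lam gam rho \<longleftrightarrow>
     is_partition gam \<and> is_partition rho \<and> contained rho gam \<and>
     (\<forall>i. card {j. (i, j) \<in> skew_diagram gam rho} = part lam i) \<and>
     (\<forall>c \<in> skew_diagram gam rho. hook_length gam rho c \<le> k) \<and>
     (\<forall>c \<in> diagram rho. k < hook_length gam rho c)"

text \<open>
  Uniqueness of the skew diagram determines the pair \<open>(gam, rho)\<close>, as for \<open>k\<close>-bounded \<open>lam\<close>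
  no row or column of \<open>gam\<close> is devoid of cells of the skew diagram: the highest square
  of \<open>rho\<close> in an empty row or column would have hook-length at most \<open>k\<close>.
\<close>

definition k_skew :: "nat \<Rightarrow> nat list \<Rightarrow> nat list \<times> nat list" where
  "k_skew k lam = (THE (gam, rho). is_k_skew k lam gam rho)"

definition k_conjugate :: "nat \<Rightarrow> nat list \<Rightarrow> nat list" where
  "k_conjugate k lam = (case k_skew k lam of (gam, rho) \<Rightarrow>
     map (\<lambda>j. card {i. (i, j) \<in> skew_diagram gam rho}) [0..<part gam 0])"

definition k_covers :: "nat \<Rightarrow> nat list \<Rightarrow> nat list \<Rightarrow> bool" where
  "k_covers k lam mu \<longleftrightarrow>
     lam \<in> bounded_partitions k \<and> mu \<in> bounded_partitions k \<and>
     contained lam mu \<and> contained (k_conjugate k lam) (k_conjugate k mu) \<and>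
     sum_list mu = sum_list lam + 1"

definition k_le :: "nat \<Rightarrow> nat list \<Rightarrow> nat list \<Rightarrow> bool" where
  "k_le k = (k_covers k)\<^sup>*\<^sup>*"

definition rect_ideal :: "nat \<Rightarrow> nat \<Rightarrow> nat \<Rightarrow> nat list set" where
  "rect_ideal k m n = {mu \<in> bounded_partitions k. k_le k mu (replicate n m)}"

end

theory Submission
  imports Defs
begin

text \<open>
  Let \<open>K = k - m + 1\<close>. The ideal consists of the partitions inside the rectangle \<open>(m\<^sup>n)\<close>
  that have at most \<open>K\<close> parts smaller than \<open>m\<close> (lemma \<open>rect_ideal_eq\<close>); once this is known, the
  count is Pascal's rule.

  The \<open>k\<close>-skew diagram of a partition is built from its top row, the smallest part, downwards.
  Below rows whose columns have heights \<open>h\<close>, a row of length \<open>a\<close> slides to the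
  first column \<open>j\<close> with \<open>h j + a \<le> k\<close>, because the hook of its first cell is \<open>h j + a\<close>. So
  the column heights, that is, the \<open>k\<close>-conjugate, obey a recursion on the list of parts that
  no longer mentions diagrams: \<open>heights\<close>, justified by \<open>part_k_conjugate\<close>.

  Suppose that \<open>lam\<close> has more than \<open>K\<close> parts smaller than \<open>m\<close>. Among its top \<open>K + 1\<close> rows, none
  has to slide, since each has length at most \<open>k - K\<close> and at most \<open>K\<close> rows above it. So the
  first column reaches height \<open>K + 1\<close>. The columns of the \<open>k\<close>-skew diagram of \<open>(m\<^sup>n)\<close> have height
  at most \<open>K\<close>, and containment of \<open>k\<close>-conjugates is transitive along chains of covers, so \<open>lam\<close>
  is not in the ideal.

  Conversely, let \<open>lam\<close> lie in the rectangle and have at most \<open>K\<close> parts smaller than \<open>m\<close>.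
  The short rows are flush left. A row of length \<open>m\<close> starts at the first column of height below \<open>K\<close>,
  so it occupies a window of \<open>m\<close> adjacent columns, which moves past a column when that column
  reaches height \<open>K\<close>. The cells of column \<open>i\<close> of the diagram of \<open>lam\<close> thus fill up the columns
  \<open>i\<close>, \<open>m + i\<close>, \<open>2 m + i\<close>, ... in packets of \<open>K\<close> (lemma \<open>heights_short_parts_le\<close>). This
  description is monotone in \<open>lam\<close>; hence between such partitions every containment that adds one
  cell is a cover, and adding cells one at a time leads up to \<open>(m\<^sup>n)\<close>.
\<close>

section \<open>Parts of a partition\<close>

lemma part_Nil [simp]: "part [] i = 0"
  by (simp add: part_def)

lemma part_Cons_0 [simp]: "part (a # l) 0 = a"
  by (simp add: part_def)

lemma part_Cons_Suc [simp]: "part (a # l) (Suc i) = part l i"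
  by (simp add: part_def)

lemma part_tl: "part (tl l) i = part l (Suc i)"
  by (cases l) simp_all

lemma part_pos_imp_less_length: "0 < part l i \<Longrightarrow> i < length l"
  by (auto simp: part_def nth_default_def split: if_splits)

lemma is_partition_Nil [simp]: "is_partition []"
  by (simp add: is_partition_def)

lemma is_partition_Cons:
  "is_partition (a # l) \<longleftrightarrow> 0 < a \<and> is_partition l \<and> (\<forall>p\<in>set l. p \<le> a)"
  by (auto simp: is_partition_def)

lemma is_partition_tl: "is_partition l \<Longrightarrow> is_partition (tl l)"
  by (cases l) (simp_all add: is_partition_Cons)

lemma is_partition_Cons_part:
  "is_partition (a # l) \<longleftrightarrow> 0 < a \<and> is_partition l \<and> part l 0 \<le> a"
  by (cases l) (auto simp: is_partition_Cons)

lemma part_le_part_0: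
  assumes "is_partition l"
  shows "part l i \<le> part l 0"
  using assms by (cases l; cases i) (auto simp: is_partition_Cons part_def nth_default_def)

lemma bounded_partitions_iff:
  "lam \<in> bounded_partitions k \<longleftrightarrow> is_partition lam \<and> (\<forall>p\<in>set lam. p \<le> k)"
  by (cases lam) (auto simp: bounded_partitions_def is_partition_Cons)

lemma is_partition_eqI:
  assumes "is_partition l" "is_partition l'" "part l 0 = part l' 0" "tl l = tl l'"
  shows "l = l'"
  using assms by (cases l; cases l') (auto simp: is_partition_Cons)

section \<open>The skew diagram without its bottom row\<close>

definition column_height :: "nat list \<Rightarrow> nat list \<Rightarrow> nat \<Rightarrow> nat" where
  "column_height gam rho j = card {i. (i, j) \<in> skew_diagram gam rho}"

lemma finite_skew_column: "finite {i. (i, j) \<in> skew_diagram gam rho}"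
  by (rule finite_subset[of _ "{..<length gam}"])
     (auto simp: skew_diagram_def intro!: part_pos_imp_less_length)

lemma column_height_tl:
  "column_height gam rho j =
     column_height (tl gam) (tl rho) j + (if part rho 0 \<le> j \<and> j < part gam 0 then 1 else 0)"
proof -
  have "{i. (i, j) \<in> skew_diagram gam rho} =
     Suc ` {i. (i, j) \<in> skew_diagram (tl gam) (tl rho)} \<union>
     (if part rho 0 \<le> j \<and> j < part gam 0 then {0} else {})"
    by (auto simp: skew_diagram_def part_tl image_iff gr0_conv_Suc split: if_splits)
       (metis not0_implies_Suc)+
  then show ?thesis
    by (simp add: column_height_def card_image card_insert_if finite_skew_column)
qed

lemma hook_length_bottom_row:
  "hook_length gam rho (0, j) =
     (part gam 0 - max j (part rho 0)) + column_height (tl gam) (tl rho) j"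
proof -
  have *: "{(i', j') \<in> skew_diagram gam rho. (i' = 0 \<and> j \<le> j') \<or> (0 \<le> i' \<and> j' = j)} =
    Pair 0 ` {max j (part rho 0)..<part gam 0} \<union>
    (\<lambda>i. (Suc i, j)) ` {i. (i, j) \<in> skew_diagram (tl gam) (tl rho)}" (is "?A = ?B")
  proof (rule set_eqI)
    fix x show "x \<in> ?A \<longleftrightarrow> x \<in> ?B"
      by (cases x; cases "fst x") (auto simp: skew_diagram_def part_tl)
  qed
  show ?thesis unfolding hook_length_def prod.case *
    by (subst card_Un_disjoint)
       (auto simp: finite_skew_column column_height_def card_image inj_on_def)
qed

lemma hook_length_Suc:
  "hook_length gam rho (Suc i, j) = hook_length (tl gam) (tl rho) (i, j)"
proof -
  have "{(i', j') \<in> skew_diagram gam rho. (i' = Suc i \<and> j \<le> j') \<or> (Suc i \<le> i' \<and> j' = j)} =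
    map_prod Suc id ` {(i', j') \<in> skew_diagram (tl gam) (tl rho).
       (i' = i \<and> j \<le> j') \<or> (i \<le> i' \<and> j' = j)}" (is "?A = ?B")
  proof (rule set_eqI)
    fix x show "x \<in> ?A \<longleftrightarrow> x \<in> ?B"
      by (cases x; cases "fst x") (auto simp: skew_diagram_def part_tl image_iff)
  qed
  moreover have "inj (map_prod Suc (id :: nat \<Rightarrow> nat))"
    by (auto simp: inj_on_def)
  ultimately show ?thesis
    by (simp add: hook_length_def card_image inj_on_subset)
qed

lemma all_nat_0_Suc: "(\<forall>i. P i) \<longleftrightarrow> P 0 \<and> (\<forall>i. P (Suc i))"
  by (metis not0_implies_Suc)

lemma is_k_skew_alt:
  "is_k_skew k lam gam rho \<longleftrightarrow> is_partition gam \<and> is_partition rho \<and>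
     (\<forall>i. part gam i = part rho i + part lam i) \<and>
     (\<forall>i. \<forall>j. part rho i \<le> j \<and> j < part gam i \<longrightarrow> hook_length gam rho (i, j) \<le> k) \<and>
     (\<forall>i. \<forall>j. j < part rho i \<longrightarrow> k < hook_length gam rho (i, j))"
proof -
  have row: "card {j. (i, j) \<in> skew_diagram gam rho} = part gam i - part rho i" for i
  proof -
    have "{j. (i, j) \<in> skew_diagram gam rho} = {part rho i..<part gam i}"
      by (auto simp: skew_diagram_def)
    then show ?thesis by simp
  qed
  have "contained rho gam \<and> (\<forall>i. part gam i - part rho i = part lam i) \<longleftrightarrow>
      (\<forall>i. part gam i = part rho i + part lam i)"
    unfolding contained_def
    by (metis add_diff_cancel_left' le_add1 le_add_diff_inverse)
  then show ?thesis
    unfolding is_k_skew_def row by (auto simp: skew_diagram_def diagram_def)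
qed

text \<open>
  Hook lengths of a row depend only on that row and the rows above it. Deleting the bottom row
  therefore leaves a \<open>k\<close>-skew diagram, and the hooks of the bottom row see the rest only through
  its column heights.
\<close>

lemma is_k_skew_Cons:
  "is_k_skew k (a # l) gam rho \<longleftrightarrow>
     is_k_skew k l (tl gam) (tl rho) \<and> is_partition gam \<and> is_partition rho \<and>
     part gam 0 = part rho 0 + a \<and>
     (\<forall>j<part rho 0. k < column_height (tl gam) (tl rho) j + a) \<and>
     (\<forall>j. part rho 0 \<le> j \<and> j < part gam 0 \<longrightarrow>
        column_height (tl gam) (tl rho) j + (part gam 0 - j) \<le> k)"
proof -
  have rows: "(\<forall>i. part gam i = part rho i + part (a # l) i) \<longleftrightarrow>
      part gam 0 = part rho 0 + a \<and> (\<forall>i. part (tl gam) i = part (tl rho) i + part l i)"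
    by (subst all_nat_0_Suc) (simp add: part_tl)
  have cells: "(\<forall>i. \<forall>j. part rho i \<le> j \<and> j < part gam i \<longrightarrow> hook_length gam rho (i, j) \<le> k) \<longleftrightarrow>
      (\<forall>j. part rho 0 \<le> j \<and> j < part gam 0 \<longrightarrow>
        column_height (tl gam) (tl rho) j + (part gam 0 - j) \<le> k) \<and>
      (\<forall>i. \<forall>j. part (tl rho) i \<le> j \<and> j < part (tl gam) i \<longrightarrow>
        hook_length (tl gam) (tl rho) (i, j) \<le> k)"
    by (subst all_nat_0_Suc)
       (simp add: part_tl hook_length_Suc hook_length_bottom_row max_absorb1 add.commute)
  have below: "(\<forall>i. \<forall>j. j < part rho i \<longrightarrow> k < hook_length gam rho (i, j)) \<longleftrightarrow>
      (\<forall>j<part rho 0. k < column_height (tl gam) (tl rho) j + a) \<and>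
      (\<forall>i. \<forall>j. j < part (tl rho) i \<longrightarrow> k < hook_length (tl gam) (tl rho) (i, j))"
    if "part gam 0 = part rho 0 + a"
    by (subst all_nat_0_Suc)
       (simp add: part_tl hook_length_Suc hook_length_bottom_row that add.commute max_absorb2)
  show ?thesis
    unfolding is_k_skew_alt rows cells using below is_partition_tl by blast
qed

text \<open>
  A nonempty inner partition would have a topmost row, whose squares have hook length 0.
\<close>

lemma is_k_skew_Nil: "is_k_skew k [] gam rho \<longleftrightarrow> gam = [] \<and> rho = []"
proof
  assume *: "is_k_skew k [] gam rho"
  have "rho = []"
  proof (rule ccontr)
    assume "rho \<noteq> []"
    define t where "t = length rho - 1"
    have "0 < part rho t"
      using \<open>rho \<noteq> []\<close> * by (auto simp: t_def part_def nth_default_def is_k_skew_alt is_partition_def)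
    then have "k < hook_length gam rho (t, 0)"
      using * by (auto simp: is_k_skew_alt)
    moreover have "skew_diagram gam rho = {}"
      using * by (auto simp: is_k_skew_alt skew_diagram_def)
    ultimately show False
      by (simp add: hook_length_def)
  qed
  moreover have "gam = []"
    using * \<open>rho = []\<close> by (cases gam) (auto simp: is_k_skew_alt is_partition_Cons dest: spec[of _ 0])
  ultimately show "gam = [] \<and> rho = []" by simp
qed (simp add: is_k_skew_alt)

section \<open>The k-conjugate as a recursion on the parts\<close>

definition row_offset :: "nat \<Rightarrow> nat \<Rightarrow> (nat \<Rightarrow> nat) \<Rightarrow> nat" where
  "row_offset k a h = (LEAST j. h j + a \<le> k)"

definition slide_row :: "nat \<Rightarrow> nat \<Rightarrow> (nat \<Rightarrow> nat) \<Rightarrow> nat \<Rightarrow> nat" where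
  "slide_row k a h j =
     h j + (if row_offset k a h \<le> j \<and> j < row_offset k a h + a then 1 else 0)"

text \<open>
  The head of the list, the largest part, is the bottom row, which is placed last.
\<close>

primrec heights :: "nat \<Rightarrow> nat list \<Rightarrow> nat \<Rightarrow> nat" where
  "heights k [] = (\<lambda>_. 0)"
| "heights k (a # l) = slide_row k a (heights k l)"

lemma heights_eventually_0: "\<exists>b. \<forall>j\<ge>b. heights k l j = 0"
proof (induction l)
  case (Cons a l)
  then obtain b where "\<forall>j\<ge>b. heights k l j = 0" by blast
  then show ?case
    by (auto simp: slide_row_def intro!: exI[of _ "max b (row_offset k a (heights k l) + a)"])
qed simp

text \<open>
  Only finitely many columns are occupied, so the search for a place always ends.
\<close>

lemma row_offset_fits:
  assumes "a \<le> k"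
  shows "heights k l (row_offset k a (heights k l)) + a \<le> k"
proof -
  obtain b where "heights k l b = 0" using heights_eventually_0 by blast
  then show ?thesis
    unfolding row_offset_def using assms
    by (intro LeastI[where P = "\<lambda>j. heights k l j + a \<le> k" and k = b]) simp
qed

lemma row_offset_minimal: "j < row_offset k a h \<Longrightarrow> k < h j + a"
  unfolding row_offset_def using not_less_Least[of j "\<lambda>j. h j + a \<le> k"] by simp

lemma row_offset_le: "h j + a \<le> k \<Longrightarrow> row_offset k a h \<le> j"
  by (simp add: row_offset_def Least_le)

text \<open>
  Heights could only begin to increase at the left end of the new row, and there the column
  on the left, being too high for the row to start in it, is strictly higher than the column on
  the right.
\<close>

lemma antimono_slide_row:
  assumes "antimono h" "h (row_offset k a h) + a \<le> k"
  shows "antimono (slide_row k a h)"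
proof (rule antimonoI)
  fix i j :: nat assume "i \<le> j"
  then have "h j \<le> h i" using assms(1) by (simp add: antimonoD)
  have "h j < h i" if "i < row_offset k a h" "row_offset k a h \<le> j"
  proof -
    have "h j \<le> h (row_offset k a h)" using assms(1) that by (simp add: antimonoD)
    then show ?thesis using row_offset_minimal[OF that(1)] assms(2) by linarith
  qed
  then show "slide_row k a h j \<le> slide_row k a h i"
    using \<open>h j \<le> h i\<close> \<open>i \<le> j\<close> by (auto simp: slide_row_def)
qed

lemma antimono_heights: "\<forall>p\<in>set l. p \<le> k \<Longrightarrow> antimono (heights k l)"
  by (induction l) (auto simp: antimono_slide_row row_offset_fits intro: antimonoI)

text \<open>
  Since the heights decrease, the row's later cells have shorter hooks than its first cell. The
  result is again a skew diagram: a square of the inner partition in the row above the new one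
  has hook length greater than \<open>k\<close>, so the new row, which is at least as long, cannot start in its column either.
\<close>

lemma k_skew_exists:
  assumes "is_partition lam" "\<forall>p\<in>set lam. p \<le> k"
  shows "\<exists>gam rho. is_k_skew k lam gam rho \<and> column_height gam rho = heights k lam"
  using assms
proof (induction lam)
  case Nil
  then show ?case
    by (auto simp: is_k_skew_Nil column_height_def skew_diagram_def fun_eq_iff)
next
  case (Cons a l)
  then obtain gam rho where skew: "is_k_skew k l gam rho"
    and cols: "column_height gam rho = heights k l"
    by (auto simp: is_partition_Cons)
  have a: "0 < a" "a \<le> k" "part l 0 \<le> a"
    using Cons.prems by (auto simp: is_partition_Cons_part)
  define r where "r = row_offset k a (heights k l)"
  define gam' where "gam' = (r + a) # gam"
  define rho' where "rho' = (if r = 0 then [] else r # rho)"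
  have parts: "is_partition gam" "is_partition rho" "part gam 0 = part rho 0 + part l 0"
    using skew by (auto simp: is_k_skew_alt)
  have "part rho 0 \<le> r"
  proof (rule ccontr)
    assume "\<not> part rho 0 \<le> r"
    then have "k < hook_length gam rho (0, r)"
      using skew by (auto simp: is_k_skew_alt)
    also have "\<dots> = part l 0 + column_height (tl gam) (tl rho) r"
      using parts \<open>\<not> part rho 0 \<le> r\<close> by (simp add: hook_length_bottom_row)
    also have "\<dots> \<le> a + heights k l r"
      using a(3) by (simp flip: cols add: column_height_tl[of gam])
    finally show False
      using row_offset_fits[OF a(2), of l] by (simp add: r_def)
  qed
  then have rho': "part rho' 0 = r" "tl rho' = rho" "is_partition rho'"
    using parts by (cases rho; auto simp: rho'_def is_partition_Cons_part)+
  have "part gam 0 \<le> r + a"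
    using parts \<open>part rho 0 \<le> r\<close> a(3) by simp
  then have gam': "part gam' 0 = r + a" "tl gam' = gam" "is_partition gam'"
    using parts a(1) by (auto simp: gam'_def is_partition_Cons_part)
  have "is_k_skew k (a # l) gam' rho'"
    unfolding is_k_skew_Cons rho' gam' cols
  proof (intro conjI allI impI)
    show "k < heights k l j + a" if "j < r" for j
      using that unfolding r_def by (rule row_offset_minimal)
    show "heights k l j + (r + a - j) \<le> k" if "r \<le> j \<and> j < r + a" for j
    proof -
      have "heights k l j \<le> heights k l r"
        using that antimono_heights[of l k] Cons.prems by (simp add: antimonoD)
      then show ?thesis
        using that row_offset_fits[OF a(2), of l] unfolding r_def by linarith
    qed
  qed (use skew rho' gam' in auto)
  moreover have "column_height gam' rho' = heights k (a # l)"
    by (rule ext) (simp add: column_height_tl[of gam'] rho' gam' cols slide_row_def r_def)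
  ultimately show ?case by blast
qed

text \<open>
  The hook conditions on the bottom row say that its first column is the first one in which it
  fits; as the row is nonempty, this determines it.
\<close>

lemma k_skew_unique:
  assumes "is_partition lam" "is_k_skew k lam gam rho" "is_k_skew k lam gam' rho'"
  shows "gam = gam' \<and> rho = rho'"
  using assms
proof (induction lam arbitrary: gam rho gam' rho')
  case Nil
  then show ?case by (simp add: is_k_skew_Nil)
next
  case (Cons a l)
  have tl: "tl gam = tl gam'" "tl rho = tl rho'"
    using Cons.IH[of "tl gam" "tl rho" "tl gam'" "tl rho'"] Cons.prems
    by (auto simp: is_k_skew_Cons is_partition_Cons)
  have "0 < a" using Cons.prems by (simp add: is_partition_Cons)
  have *: "part rho 0 = row_offset k a (column_height (tl gam) (tl rho))"
    if "is_k_skew k (a # l) gam rho" for gam rho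
    unfolding row_offset_def
  proof (rule Least_equality[symmetric])
    show "column_height (tl gam) (tl rho) (part rho 0) + a \<le> k"
      using that \<open>0 < a\<close> by (auto simp: is_k_skew_Cons dest: spec[of _ "part rho 0"])
    show "part rho 0 \<le> j" if "column_height (tl gam) (tl rho) j + a \<le> k" for j
      using that \<open>is_k_skew k (a # l) gam rho\<close> by (auto simp: is_k_skew_Cons not_le[symmetric])
  qed
  have "part rho 0 = part rho' 0"
    using *[OF Cons.prems(2)] *[OF Cons.prems(3)] tl by simp
  moreover from this have "part gam 0 = part gam' 0"
    using Cons.prems by (simp add: is_k_skew_Cons)
  ultimately show ?case
    using Cons.prems tl by (auto simp: is_k_skew_Cons intro: is_partition_eqI)
qed

lemma part_k_conjugate:
  assumes "lam \<in> bounded_partitions k"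
  shows "part (k_conjugate k lam) = heights k lam"
proof -
  have lam: "is_partition lam" "\<forall>p\<in>set lam. p \<le> k"
    using assms by (simp_all add: bounded_partitions_iff)
  then obtain gam rho where skew: "is_k_skew k lam gam rho"
    and cols: "column_height gam rho = heights k lam"
    using k_skew_exists by blast
  have "k_skew k lam = (gam, rho)"
    unfolding k_skew_def
  proof (rule the_equality)
    show "case (gam, rho) of (gam, rho) \<Rightarrow> is_k_skew k lam gam rho"
      by (simp add: skew)
    show "p = (gam, rho)" if "case p of (gam, rho) \<Rightarrow> is_k_skew k lam gam rho" for p
      using that k_skew_unique[OF lam(1) _ skew, of "fst p" "snd p"]
      by (cases p) simp
  qed
  then have conj: "k_conjugate k lam = map (column_height gam rho) [0..<part gam 0]"
    by (simp add: k_conjugate_def column_height_def)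
  have "column_height gam rho j = 0" if "part gam 0 \<le> j" for j
  proof -
    have "part gam i \<le> part gam 0" for i
      by (rule part_le_part_0) (use skew in \<open>simp add: is_k_skew_alt\<close>)
    then have "{i. (i, j) \<in> skew_diagram gam rho} = {}"
      using that by (auto simp: skew_diagram_def not_less intro: order_trans)
    then show ?thesis by (simp add: column_height_def)
  qed
  then show ?thesis
    by (intro ext) (auto simp: conj part_def nth_default_def simp flip: cols)
qed

section \<open>Column heights when all but a few parts are equal to m\<close>

text \<open>
  As a function of \<open>i\<close>, this lists the column lengths of the diagram of \<open>lam\<close>, that is, its ordinary
  conjugate.
\<close>

definition parts_above :: "nat list \<Rightarrow> nat \<Rightarrow> nat" where
  "parts_above lam i = length (filter (\<lambda>p. i < p) lam)"

lemma parts_above_Nil [simp]: "parts_above [] i = 0"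
  by (simp add: parts_above_def)

lemma parts_above_Cons [simp]:
  "parts_above (a # l) i = (if i < a then Suc (parts_above l i) else parts_above l i)"
  by (simp add: parts_above_def)

lemma parts_above_append [simp]: "parts_above (l @ l') i = parts_above l i + parts_above l' i"
  by (simp add: parts_above_def)

lemma parts_above_le_length: "parts_above lam i \<le> length lam"
  by (simp add: parts_above_def)

lemma antimono_parts_above: "i \<le> j \<Longrightarrow> parts_above lam j \<le> parts_above lam i"
  by (induction lam) auto

lemma parts_above_eq_0: "\<forall>p\<in>set lam. p \<le> i \<Longrightarrow> parts_above lam i = 0"
  by (induction lam) auto

lemma parts_above_0: "\<forall>p\<in>set lam. 0 < p \<Longrightarrow> parts_above lam 0 = length lam"
  by (simp add: parts_above_def)

text \<open>
  With this few and short parts every hook of the ordinary diagram has length at most \<open>k\<close>, so no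
  row has to slide.
\<close>

lemma heights_eq_parts_above:
  assumes "\<forall>p\<in>set lam. p + length lam \<le> k + 1"
  shows "heights k lam = parts_above lam"
  using assms
proof (induction lam)
  case (Cons a l)
  then have IH: "heights k l = parts_above l"
    by fastforce
  have "row_offset k a (heights k l) \<le> 0"
    using Cons.prems parts_above_le_length[of l 0] by (intro row_offset_le) (simp add: IH)
  then show ?case
    by (auto simp: slide_row_def IH)
qed auto

lemma heights_le_heights_append: "heights k l j \<le> heights k (xs @ l) j"
  by (induction xs) (auto simp: slide_row_def intro: le_SucI)

text \<open>
  Write a column as \<open>c = q * m + i\<close> with \<open>i < m\<close>. Think of \<open>v i\<close> cells that are stacked in the
  columns \<open>i\<close>, \<open>m + i\<close>, \<open>2 * m + i\<close>, ... up to height \<open>K\<close> each. The columns that a row of length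
  \<open>m\<close> enters are the first \<open>m\<close> columns of height below \<open>K\<close>, hence one column of each residue class
  modulo \<open>m\<close>, namely the one that is being filled. So the row adds one cell to each stack. In the
  proof, \<open>f c\<close> is the signed number of cells of the stack that remain when column \<open>c\<close> is reached;
  the two hypotheses on \<open>v\<close> make it antimonotone within a period and across its end.
\<close>

lemma slide_row_window:
  assumes "0 < m" "0 < K" "m + K = k + 1"
    and anti: "\<And>i j. i \<le> j \<Longrightarrow> j < m \<Longrightarrow> v j \<le> v i"
    and spread: "v 0 \<le> v (m - 1) + K"
    and h: "\<And>c. h c = min K (v (c mod m) - K * (c div m))"
  shows "slide_row k m h c = min K (Suc (v (c mod m)) - K * (c div m))"
proof -
  define f where "f c = int (v (c mod m)) - int K * int (c div m)" for c
  have clamp: "min K (x - K * (c div m)) = nat (min (int K) (int x - int K * int (c div m)))" for x c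
  proof -
    have "int (x - y) = max 0 (int x - int y)" for y
      by linarith
    from this[of "K * (c div m)"]
    have "int (x - K * (c div m)) = max 0 (int x - int K * int (c div m))"
      by simp
    then show ?thesis by linarith
  qed
  have hf: "h c = nat (min (int K) (f c))" for c
    unfolding h clamp f_def ..
  \<comment> \<open>This would fail for \<open>K = 0\<close>: truncation hides the sign of \<open>f c\<close>.\<close>
  have full: "int K \<le> f c" if "K \<le> h c" for c
    using that assms(2) unfolding hf
    by (cases "0 \<le> f c") (auto simp: le_nat_iff min_def split: if_splits)
  have "f (Suc c) \<le> f c" for c
  proof (cases "Suc (c mod m) = m")
    case True
    then have "c mod m = m - 1" by simp
    then show ?thesis
      using True spread by (simp add: f_def mod_Suc div_Suc algebra_simps)
  next
    case False
    moreover have "c mod m < m" using assms(1) by simp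
    ultimately have "Suc (c mod m) < m" by linarith
    then show ?thesis
      using False anti[of "c mod m" "Suc (c mod m)"] by (simp add: f_def mod_Suc div_Suc)
  qed
  then have f_antimono: "f c' \<le> f c" if "c \<le> c'" for c c'
    using that lift_Suc_antimono_le[of f] by blast
  have f_shift: "f (c + m) = f c - int K" for c
    using assms(1) by (simp add: f_def div_add_self2 algebra_simps del: mult_Suc_right)
  define r where "r = row_offset k m h"
  \<comment> \<open>The \<open>v 0\<close> cells of the stack \<open>i = 0\<close> fill at most \<open>v 0\<close> columns, so its column number \<open>v 0\<close> is empty.\<close>
  have "h (m * v 0) = 0"
    using assms(1,2) by (simp add: h)
  then have "h r + m \<le> k"
    unfolding r_def row_offset_def using assms(2,3)
    by (intro LeastI[where P = "\<lambda>j. h j + m \<le> k" and k = "m * v 0"]) simp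
  then have "f r < int K"
    using assms(2,3) by (simp add: hf)
  consider "c < r" | "r \<le> c" "c < r + m" | "r + m \<le> c"
    by linarith
  then have "slide_row k m h c = nat (min (int K) (f c + 1))"
  proof cases
    case 1
    then have "k < h c + m" unfolding r_def by (rule row_offset_minimal)
    then have "int K \<le> f c" using assms(3) by (intro full) linarith
    then show ?thesis using 1 by (simp add: slide_row_def r_def hf)
  next
    case 2
    \<comment> \<open>The column is empty or being filled: one period earlier the stack had filled its column.\<close>
    have "0 \<le> f c"
    proof (cases "c < m")
      case True
      then show ?thesis by (simp add: f_def)
    next
      case False
      then have "c - m < r" using 2 by linarith
      then have "k < h (c - m) + m" unfolding r_def by (rule row_offset_minimal)
      then have "int K \<le> f (c - m)" using assms(3) by (intro full) linarith
      then show ?thesis using f_shift[of "c - m"] False by simp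
    qed
    moreover have "f c < int K" using f_antimono[OF 2(1)] \<open>f r < int K\<close> by linarith
    ultimately show ?thesis using 2 by (simp add: slide_row_def r_def hf)
  next
    case 3
    \<comment> \<open>The column \<open>c\<close> is a full period after a column that is not yet full, so even one more cell
      does not reach it.\<close>
    have "f c < 0" using f_antimono[OF 3] f_shift[of r] \<open>f r < int K\<close> by linarith
    then show ?thesis using 3 by (simp add: slide_row_def r_def hf)
  qed
  also have "\<dots> = min K (Suc (v (c mod m)) - K * (c div m))"
    unfolding clamp f_def by (simp add: algebra_simps)
  finally show ?thesis .
qed

definition short_parts_le :: "nat \<Rightarrow> nat \<Rightarrow> nat list \<Rightarrow> bool" where
  "short_parts_le m K lam \<longleftrightarrow> is_partition lam \<and> (\<forall>p\<in>set lam. p \<le> m) \<and>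
     length (filter (\<lambda>p. p < m) lam) \<le> K"

lemma short_parts_le_Cons_max:
  "0 < m \<Longrightarrow> short_parts_le m K (m # l) \<longleftrightarrow> short_parts_le m K l"
  by (auto simp: short_parts_le_def is_partition_Cons)

lemma short_parts_le_Cons_less:
  assumes "short_parts_le m K (a # l)" "a < m"
  shows "length (a # l) \<le> K"
proof -
  have "\<forall>p\<in>set (a # l). p < m"
    using assms by (auto simp: short_parts_le_def is_partition_Cons)
  then have "filter (\<lambda>p. p < m) (a # l) = a # l"
    by (simp only: filter_id_conv)
  then show ?thesis
    using assms by (simp add: short_parts_le_def del: filter.simps)
qed

text \<open>
  The short parts form an ordinary diagram, of at most \<open>K\<close> rows, which starts the stacks. Each
  further part \<open>m\<close> adds a cell to every stack. The number of parts smaller than \<open>m\<close> is the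
  difference between the longest and the shortest stack, which bounds the spread in
  \<open>slide_row_window\<close>.
\<close>

lemma heights_short_parts_le:
  assumes "0 < m" "0 < K" "m + K = k + 1" "short_parts_le m K lam"
  shows "heights k lam c = min K (parts_above lam (c mod m) - K * (c div m))"
  using assms(4)
proof (induction lam arbitrary: c)
  case (Cons a l)
  show ?case
  proof (cases "a = m")
    case True
    then have l: "short_parts_le m K l"
      using Cons.prems assms(1) by (simp add: short_parts_le_Cons_max)
    have "(\<lambda>p. \<not> p < m) = (\<lambda>p. m - 1 < p)"
      using assms(1) by auto
    then have "length l = parts_above l (m - 1) + length (filter (\<lambda>p. p < m) l)"
      using sum_length_filter_compl[of "\<lambda>p. p < m" l]
      by (simp add: parts_above_def)
    then have "parts_above l 0 \<le> parts_above l (m - 1) + K"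
      using l parts_above_le_length[of l 0] by (simp add: short_parts_le_def)
    then have "slide_row k m (heights k l) c =
        min K (Suc (parts_above l (c mod m)) - K * (c div m))"
      using assms(1-3) Cons.IH[OF l]
      by (intro slide_row_window) (auto intro: antimono_parts_above)
    then show ?thesis using True assms(1) by simp
  next
    case False
    then have a: "a < m"
      using Cons.prems by (simp add: short_parts_le_def)
    then have len: "length (a # l) \<le> K"
      using short_parts_le_Cons_less Cons.prems by blast
    have small: "\<forall>p\<in>set (a # l). p < m"
      using Cons.prems a by (auto simp: short_parts_le_def is_partition_Cons)
    have "p + length (a # l) \<le> k + 1" if "p \<in> set (a # l)" for p
      using small that len assms(3) by fastforce
    then have *: "heights k (a # l) = parts_above (a # l)"
      by (intro heights_eq_parts_above) blast
    have bound: "parts_above (a # l) i \<le> K" for i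
      using len parts_above_le_length[of "a # l" i] by linarith
    show ?thesis
    proof (cases "c < m")
      case True
      then show ?thesis using bound[of c] by (simp add: * del: heights.simps parts_above_Cons)
    next
      case False
      have "\<forall>p\<in>set (a # l). p \<le> c" using small False by force
      then have "parts_above (a # l) c = 0" by (rule parts_above_eq_0)
      moreover have "0 < c div m" using False assms(1) by (simp add: div_greater_zero_iff)
      then have "K \<le> K * (c div m)" by simp
      then have "parts_above (a # l) (c mod m) \<le> K * (c div m)"
        using bound[of "c mod m"] by linarith
      ultimately show ?thesis by (simp add: * del: heights.simps parts_above_Cons)
    qed
  qed
qed simp

section \<open>Elements of the ideal have at most k - m + 1 short parts\<close>

lemma partition_split:
  "is_partition lam \<Longrightarrow> lam = filter (\<lambda>p. \<not> p < m) lam @ filter (\<lambda>p. p < m) lam"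
proof (induction lam)
  case (Cons a l)
  show ?case
  proof (cases "a < m")
    case True
    then have "\<forall>p\<in>set l. p < m" using Cons.prems by (auto simp: is_partition_Cons)
    then have "filter (\<lambda>p. p < m) l = l" "filter (\<lambda>p. \<not> p < m) l = []"
      by (simp_all add: filter_empty_conv)
    then show ?thesis using True by simp
  next
    case False
    then show ?thesis using Cons by (simp add: is_partition_Cons)
  qed
qed simp

text \<open>
  The last \<open>K + 1\<close> parts are smaller than \<open>m\<close>, so they stay flush left and already make the first
  column too high; the rows placed below them do not lower it.
\<close>

lemma heights_0_short_parts:
  assumes "is_partition lam" "0 < m" "m + K = k + 1" "K < length (filter (\<lambda>p. p < m) lam)"
  shows "K < heights k lam 0"
proof -
  define short where "short = filter (\<lambda>p. p < m) lam"
  define t where "t = drop (length short - Suc K) short"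
  have len: "length t = Suc K"
    using assms(4) by (simp add: t_def short_def)
  have t: "\<forall>p\<in>set t. 0 < p \<and> p < m"
    using assms(1) by (auto simp: t_def short_def is_partition_def dest!: in_set_dropD)
  have "p + length t \<le> k + 1" if "p \<in> set t" for p
    using t that len assms(3) by fastforce
  then have "heights k t 0 = Suc K"
    using heights_eq_parts_above[of t k] t len by (simp add: parts_above_0)
  moreover have "lam = (filter (\<lambda>p. \<not> p < m) lam @ take (length short - Suc K) short) @ t"
    using partition_split[OF assms(1), of m] by (simp add: t_def flip: short_def)
  then have "heights k t 0 \<le> heights k lam 0"
    by (metis heights_le_heights_append)
  ultimately show ?thesis by simp
qed

lemma part_replicate: "part (replicate n m) i = (if i < n then m else 0)"
  by (simp add: part_def nth_default_def)

lemma contained_replicate_iff: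
  assumes "is_partition lam"
  shows "contained lam (replicate n m) \<longleftrightarrow> (\<forall>p\<in>set lam. p \<le> m) \<and> length lam \<le> n"
proof
  assume *: "contained lam (replicate n m)"
  have part: "part lam i = lam ! i" "0 < lam ! i" if "i < length lam" for i
    using that assms by (auto simp: part_def nth_default_def is_partition_def)
  have "i < n \<and> lam ! i \<le> m" if "i < length lam" for i
    using * part[OF that] unfolding contained_def part_replicate
    by (metis not_le)
  then show "(\<forall>p\<in>set lam. p \<le> m) \<and> length lam \<le> n"
    by (metis in_set_conv_nth not_le order_less_irrefl)
next
  assume "(\<forall>p\<in>set lam. p \<le> m) \<and> length lam \<le> n"
  then show "contained lam (replicate n m)"
    by (auto simp: contained_def part_replicate part_def nth_default_def)
qed

lemma k_le_imp_contained:
  assumes "k_le k lam mu"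
  shows "contained lam mu \<and> contained (k_conjugate k lam) (k_conjugate k mu)"
  using assms unfolding k_le_def
proof (induction rule: rtranclp_induct)
  case base
  then show ?case by (simp add: contained_def)
next
  case (step y z)
  then show ?case by (auto simp: k_covers_def contained_def intro: order_trans)
qed

lemma short_parts_le_replicate: "0 < m \<Longrightarrow> short_parts_le m K (replicate n m)"
  by (induction n) (simp_all add: short_parts_le_Cons_max, simp add: short_parts_le_def)

lemma short_parts_le_bounded: "short_parts_le m K lam \<Longrightarrow> m \<le> k \<Longrightarrow> lam \<in> bounded_partitions k"
  by (auto simp: short_parts_le_def bounded_partitions_iff)

lemma k_le_rectangle_imp_short_parts_le:
  assumes "0 < m" "0 < K" "m + K = k + 1" "lam \<in> bounded_partitions k" "k_le k lam (replicate n m)"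
  shows "short_parts_le m K lam \<and> length lam \<le> n"
proof -
  have lam: "is_partition lam" using assms(4) by (simp add: bounded_partitions_iff)
  note cont = k_le_imp_contained[OF assms(5)]
  have "replicate n m \<in> bounded_partitions k"
    using short_parts_le_bounded[OF short_parts_le_replicate[OF assms(1), of K n]] assms(2,3) by simp
  then have "heights k lam 0 \<le> heights k (replicate n m) 0"
    using cont assms(4) by (simp add: contained_def part_k_conjugate)
  also have "\<dots> \<le> K"
    using heights_short_parts_le[OF assms(1-3) short_parts_le_replicate[OF assms(1)], of n 0] by simp
  finally have "length (filter (\<lambda>p. p < m) lam) \<le> K"
    using heights_0_short_parts[OF lam assms(1,3)] by (meson not_le)
  then show ?thesis
    using cont lam by (simp add: contained_replicate_iff short_parts_le_def)
qed

section \<open>Partitions with at most k - m + 1 short parts lie in the ideal\<close>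

lemma is_partition_replicate_append:
  assumes "0 < m" "\<forall>p\<in>set l. p \<le> m"
  shows "is_partition (replicate a m @ l) \<longleftrightarrow> is_partition l"
  using assms by (induction a) (auto simp: is_partition_Cons)

lemma is_partition_appendD: "is_partition (xs @ l) \<Longrightarrow> is_partition l"
  by (simp add: is_partition_def sorted_wrt_append)

lemma contained_append: "contained l l' \<Longrightarrow> contained (xs @ l) (xs @ l')"
  by (auto simp: contained_def part_def nth_default_append)

lemma contained_self_append: "contained xs (xs @ l)"
  using contained_append[of "[]" l xs] by (simp add: contained_def)

text \<open>
  Lengthening the first part that is smaller than \<open>m\<close> does not increase the number of short parts.
  If there is none, a new part 1 can be added, as \<open>K\<close> is positive.
\<close>

lemma exists_larger_short_parts_le:
  assumes "0 < m" "0 < K" "short_parts_le m K lam" "length lam \<le> n" "lam \<noteq> replicate n m"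
  shows "\<exists>mu. short_parts_le m K mu \<and> length mu \<le> n \<and> contained lam mu \<and>
     (\<forall>i. parts_above lam i \<le> parts_above mu i) \<and> sum_list mu = sum_list lam + 1"
proof -
  define a where "a = length (filter (\<lambda>p. \<not> p < m) lam)"
  define nu where "nu = filter (\<lambda>p. p < m) lam"
  have "filter (\<lambda>p. \<not> p < m) lam = replicate a m"
    unfolding a_def using assms(3)
    by (intro replicate_length_same[symmetric]) (auto simp: short_parts_le_def)
  then have lam: "lam = replicate a m @ nu"
    using partition_split[of lam m] assms(3) by (simp add: nu_def short_parts_le_def)
  have nu: "\<forall>p\<in>set nu. 0 < p \<and> p < m" "length nu \<le> K"
    using assms(3) by (auto simp: nu_def short_parts_le_def is_partition_def)
  show ?thesis
  proof (cases nu)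
    case Nil
    then have "a < n" using assms(4,5) lam by (cases "a = n") simp_all
    then show ?thesis
      using Nil lam assms(1,2)
      by (intro exI[of _ "replicate a m @ [1]"])
         (auto simp: short_parts_le_def is_partition_replicate_append is_partition_Cons
            contained_self_append)
  next
    case (Cons p nu')
    have "is_partition (p # nu')"
      using assms(3) lam Cons is_partition_appendD[of "replicate a m" nu]
      by (simp add: short_parts_le_def)
    then have "is_partition (replicate a m @ Suc p # nu')"
      using Cons nu(1) assms(1)
      by (subst is_partition_replicate_append) (auto simp: is_partition_Cons intro: le_SucI)
    moreover have "contained (p # nu') (Suc p # nu')"
      unfolding contained_def by (subst all_nat_0_Suc) simp
    ultimately show ?thesis
      using Cons lam assms(1,4) nu
      by (intro exI[of _ "replicate a m @ Suc p # nu'"])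
         (auto simp: short_parts_le_def contained_append le_SucI)
  qed
qed

lemma sum_list_le_mult_length: "\<forall>p\<in>set l. p \<le> m \<Longrightarrow> sum_list l \<le> m * length (l :: nat list)"
  by (induction l) auto

text \<open>
  By \<open>heights_short_parts_le\<close> the \<open>k\<close>-conjugate is monotone in the ordinary conjugate, so the one-cell
  extensions of \<open>exists_larger_short_parts_le\<close> are covers. They end at the full rectangle.
\<close>

lemma short_parts_le_imp_k_le:
  assumes "0 < m" "0 < K" "m + K = k + 1" "short_parts_le m K lam" "length lam \<le> n"
  shows "k_le k lam (replicate n m)"
  using assms(4,5)
proof (induction "m * n - sum_list lam" arbitrary: lam rule: less_induct)
  case less
  show ?case
  proof (cases "lam = replicate n m")
    case False
    then obtain mu where mu: "short_parts_le m K mu" "length mu \<le> n" "contained lam mu"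
      "\<forall>i. parts_above lam i \<le> parts_above mu i" "sum_list mu = sum_list lam + 1"
      using exists_larger_short_parts_le[OF assms(1,2) less.prems] by blast
    have bounded: "lam \<in> bounded_partitions k" "mu \<in> bounded_partitions k"
      using short_parts_le_bounded less.prems(1) mu(1) assms(2,3) by auto
    have "heights k lam c \<le> heights k mu c" for c
      using mu(4) heights_short_parts_le[OF assms(1-3)] less.prems(1) mu(1)
      by (simp add: min.coboundedI2 diff_le_mono)
    then have "k_covers k lam mu"
      using bounded mu(3,5) by (simp add: k_covers_def contained_def part_k_conjugate)
    moreover have "sum_list mu \<le> m * n"
      using sum_list_le_mult_length[of mu m] mu(1,2)
      by (meson mult_le_mono2 order_trans short_parts_le_def)
    then have "k_le k mu (replicate n m)"
      using mu by (intro less.hyps) auto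
    ultimately show ?thesis
      unfolding k_le_def by (rule converse_rtranclp_into_rtranclp)
  qed (simp add: k_le_def)
qed

lemma rect_ideal_eq:
  assumes "0 < m" "0 < K" "m + K = k + 1"
  shows "rect_ideal k m n = {lam. short_parts_le m K lam \<and> length lam \<le> n}"
proof -
  have "m \<le> k" using assms by linarith
  then show ?thesis
    using k_le_rectangle_imp_short_parts_le[OF assms] short_parts_le_imp_k_le[OF assms]
      short_parts_le_bounded
    unfolding rect_ideal_def by blast
qed

section \<open>Counting\<close>

definition box_partitions :: "nat \<Rightarrow> nat \<Rightarrow> nat list set" where
  "box_partitions L m = {lam. is_partition lam \<and> (\<forall>p\<in>set lam. p \<le> m) \<and> length lam \<le> L}"

lemma box_partitions_0_left: "box_partitions 0 m = {[]}"
  by (auto simp: box_partitions_def)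

lemma box_partitions_0_right: "box_partitions L 0 = {[]}"
proof -
  have "lam = []" if "is_partition lam" "\<forall>p\<in>set lam. p \<le> 0" for lam
    using that by (cases lam) (auto simp: is_partition_Cons)
  then show ?thesis by (auto simp: box_partitions_def)
qed

text \<open>
  Pascal's rule: either no part equals the bound, or the first one does and can be removed.
\<close>

lemma box_partitions_Suc_Suc:
  "box_partitions (Suc L) (Suc m) =
     box_partitions (Suc L) m \<union> Cons (Suc m) ` box_partitions L (Suc m)"
proof (rule set_eqI)
  fix lam
  show "lam \<in> box_partitions (Suc L) (Suc m) \<longleftrightarrow>
    lam \<in> box_partitions (Suc L) m \<union> Cons (Suc m) ` box_partitions L (Suc m)"
    by (cases lam) (force simp: box_partitions_def is_partition_Cons le_Suc_eq)+
qed

lemma finite_card_box_partitions: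
  "finite (box_partitions L m) \<and> card (box_partitions L m) = (L + m) choose m"
proof (induction "L + m" arbitrary: L m)
  case 0
  then show ?case by (simp add: box_partitions_0_left)
next
  case (Suc s)
  show ?case
  proof (cases "L = 0 \<or> m = 0")
    case True
    then show ?thesis by (auto simp: box_partitions_0_left box_partitions_0_right)
  next
    case False
    then obtain L' m' where eq: "L = Suc L'" "m = Suc m'"
      by (meson not0_implies_Suc)
    have "box_partitions L m' \<inter> Cons m ` box_partitions L' m = {}"
      by (auto simp: box_partitions_def eq)
    then show ?thesis
      using Suc.hyps(1)[of L m'] Suc.hyps(1)[of L' m] Suc.hyps(2)
      by (simp add: eq box_partitions_Suc_Suc card_Un_disjoint card_image)
  qed
qed

lemmas finite_box_partitions = finite_card_box_partitions[THEN conjunct1]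
lemmas card_box_partitions = finite_card_box_partitions[THEN conjunct2]

text \<open>
  These are the partitions that fit in a box with \<open>K\<close> rows but not in one with \<open>K - 1\<close>.
\<close>

lemma card_box_partitions_full_length:
  assumes "0 < K" "0 < m"
  shows "card {lam \<in> box_partitions K m. length lam = K} = (K + m - 1) choose (m - 1)"
proof -
  obtain L M where eq: "K = Suc L" "m = Suc M"
    using assms by (meson gr0_implies_Suc)
  have "{lam \<in> box_partitions K m. length lam = K} = box_partitions K m - box_partitions L m"
    by (auto simp: box_partitions_def eq)
  moreover have "box_partitions L m \<subseteq> box_partitions K m"
    by (auto simp: box_partitions_def eq)
  ultimately show ?thesis
    by (simp add: card_Diff_subset finite_box_partitions card_box_partitions eq)
qed

lemma short_parts_le_of_length_le:
  assumes "length lam \<le> K"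
  shows "short_parts_le m K lam \<longleftrightarrow> lam \<in> box_partitions K m"
  using assms le_trans[OF length_filter_le[of "\<lambda>p. p < m" lam]]
  by (auto simp: short_parts_le_def box_partitions_def)

text \<open>
  A partition with more than \<open>K\<close> parts, of which at most \<open>K\<close> are smaller than \<open>m\<close>, begins with \<open>m\<close>.
  So beyond length \<open>K\<close> every length contributes the same number of partitions.
\<close>

lemma short_parts_le_length_Suc:
  assumes "0 < m" "K \<le> n"
  shows "{lam. short_parts_le m K lam \<and> length lam = Suc n} =
    Cons m ` {lam. short_parts_le m K lam \<and> length lam = n}"
proof (rule set_eqI)
  fix lam
  show "lam \<in> {lam. short_parts_le m K lam \<and> length lam = Suc n} \<longleftrightarrow>
    lam \<in> Cons m ` {lam. short_parts_le m K lam \<and> length lam = n}"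
  proof (cases lam)
    case (Cons a l)
    have "a = m" if "short_parts_le m K (a # l)" "length l = n"
    proof (rule ccontr)
      assume "a \<noteq> m"
      then have "length (a # l) \<le> K"
        using that by (intro short_parts_le_Cons_less) (auto simp: short_parts_le_def)
      then show False using assms(2) that(2) by simp
    qed
    then show ?thesis
      using Cons assms(1) by (auto simp: short_parts_le_Cons_max)
  qed auto
qed

lemma card_short_parts_le_length:
  assumes "0 < m" "0 < K"
  shows "finite {lam. short_parts_le m K lam \<and> length lam = K + d} \<and>
    card {lam. short_parts_le m K lam \<and> length lam = K + d} = (K + m - 1) choose (m - 1)"
proof (induction d)
  case 0
  have "{lam. short_parts_le m K lam \<and> length lam = K + 0} = {lam \<in> box_partitions K m. length lam = K}"
    by (auto simp: short_parts_le_of_length_le)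
  then show ?case
    using card_box_partitions_full_length[OF assms(2,1)] finite_box_partitions by simp
next
  case (Suc d)
  then show ?case
    using short_parts_le_length_Suc[OF assms(1), of K "K + d"] by (simp add: card_image)
qed

lemma card_short_parts_le:
  assumes "0 < m" "0 < K"
  shows "finite {lam. short_parts_le m K lam \<and> length lam \<le> K + d} \<and>
    card {lam. short_parts_le m K lam \<and> length lam \<le> K + d} =
      ((K + m) choose m) + d * ((K + m - 1) choose (m - 1))"
proof (induction d)
  case 0
  have "{lam. short_parts_le m K lam \<and> length lam \<le> K + 0} = box_partitions K m"
    using short_parts_le_of_length_le[of _ K m] by (auto simp: box_partitions_def)
  then show ?case by (simp add: finite_box_partitions card_box_partitions)
next
  case (Suc d)
  have "{lam. short_parts_le m K lam \<and> length lam \<le> K + Suc d} =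
    {lam. short_parts_le m K lam \<and> length lam \<le> K + d} \<union>
    {lam. short_parts_le m K lam \<and> length lam = K + Suc d}"
    by auto
  moreover have "{lam. short_parts_le m K lam \<and> length lam \<le> K + d} \<inter>
    {lam. short_parts_le m K lam \<and> length lam = K + Suc d} = {}"
    by auto
  ultimately show ?case
    using Suc card_short_parts_le_length[OF assms, of "Suc d"]
    by (simp only: finite_Un card_Un_disjoint) simp
qed

theorem corollary40:
  fixes k m n :: nat
  assumes "1 \<le> k" and "1 \<le> m" and "1 \<le> n" and "m \<le> k" and "k - m + 1 \<le> n"
  shows "int (card (rect_ideal k m n)) =
    int ((k + 1) choose m) + (int n - int k + int m - 1) * int (k choose (m - 1))"
proof -
  define K where "K = k - m + 1"
  define d where "d = n - K"
  have K: "0 < m" "0 < K" "m + K = k + 1"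
    using assms by (simp_all add: K_def)
  have n: "n = K + d" using assms by (simp add: d_def K_def)
  have "card (rect_ideal k m n) = ((k + 1) choose m) + d * (k choose (m - 1))"
    using card_short_parts_le[OF K(1,2), of d] K(3)
    unfolding rect_ideal_eq[OF K] n by (simp add: add.commute)
  moreover have "int d = int n - int k + int m - 1"
    using K(3) n by linarith
  ultimately show ?thesis by simp
qed

end
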